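(* Let $X_1,X_2,\dots$ be i.i.d. with law $P$, a probability distribution on $[0,1]$ with mean $m$ and variance $\sigma^2>0$. Let $C\ge m(1-m)$ be a constant and define the Krichevsky–Trofimov (KT) bet fractions $$\lambda_n^{\mathsf{KT}}=\frac{1/2+\sum_{k=1}^{n-1}(X_k-m)}{Cn},\qquad n\ge1.$$ Then $$\sqrt n\,\lambda_n^{\mathsf{KT}}=\frac{1/2+\sum_{k=1}^{n-1}(X_k-m)}{C\sqrt n}\longrightarrow\mathcal N(0,C^{-2}\sigma^2)\quad\text{weakly}.$$ Therefore $\lambda_n^{\mathsf{KT}}=\Omega_p(n^{-1/2})$, and consequently the KT wealth process $\prod_{k=1}^n\bigl(1+\lambda_k^{\mathsf{KT}}(X_k-m)\bigr)$ converges to $0$ almost surely as $n\to\infty$.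
   Context: For random variables $(Y_n)$ and positive nonrandom $(a_n)$, $Y_n=\Omega_p(a_n)$ means that for every $\varepsilon>0$ there is $\delta>0$ with $\mathbb P(|Y_n|\ge\delta a_n)\ge1-\varepsilon$ for all but finitely many $n$. *)

theory Defs
  imports "HOL-Probability.Probability"
begin

definition Omega_p :: "'a measure \<Rightarrow> (nat \<Rightarrow> 'a \<Rightarrow> real) \<Rightarrow> (nat \<Rightarrow> real) \<Rightarrow> bool" where
  "Omega_p M Y a \<longleftrightarrow>
     (\<forall>\<epsilon>>0. \<exists>\<delta>>0. \<forall>\<^sub>F n in sequentially.
        measure M {\<omega> \<in> space M. \<bar>Y n \<omega>\<bar> \<ge> \<delta> * a n} \<ge> 1 - \<epsilon>)"

text \<open>The sequence \<open>X\<close> and the bets are indexed from 1. The values \<open>X 0\<close> and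
  \<open>kt_bet C m X 0\<close> carry no meaning.\<close>

definition kt_bet :: "real \<Rightarrow> real \<Rightarrow> (nat \<Rightarrow> 'a \<Rightarrow> real) \<Rightarrow> nat \<Rightarrow> 'a \<Rightarrow> real" where
  "kt_bet C m X n \<omega> = (1 / 2 + (\<Sum>k\<in>{1..<n}. (X k \<omega> - m))) / (C * real n)"

definition kt_wealth :: "real \<Rightarrow> real \<Rightarrow> (nat \<Rightarrow> 'a \<Rightarrow> real) \<Rightarrow> nat \<Rightarrow> 'a \<Rightarrow> real" where
  "kt_wealth C m X n \<omega> = (\<Prod>k\<in>{1..n}. 1 + kt_bet C m X k \<omega> * (X k \<omega> - m))"

end

theory Submission
  imports Defs "HOL-Real_Asymp.Real_Asymp"
begin

text \<open>
  The bets are affine functions of random walk sums, so the central limit theorem gives the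
  weak limit, and since that limit has no atom at 0 the bets are of exact order \<open>n\<close> to
  the power \<open>- 1 / 2\<close> in probability. Integrating over the event that \<open>\<Sum> \<lambda>\<^sub>k\<^sup>2\<close> is bounded and comparing
  with the harmonic series, \<open>\<Sum> \<lambda>\<^sub>k\<^sup>2 = \<infinity>\<close> almost surely.

  For the wealth, take square roots: by \<open>sqrt (1 + u) \<le> 1 + u / 2 - u\<^sup>2 / 16\<close> for \<open>\<bar>u\<bar> \<le> 1 / 2\<close>,
  the process \<open>\<Prod> sqrt (1 + \<lambda>\<^sub>k (X\<^sub>k - m)) * exp (\<sigma>\<^sup>2 \<lambda>\<^sub>k\<^sup>2 / 16)\<close> is a nonnegative
  supermartingale whenever the bets are bounded by \<open>1 / 2\<close>, hence almost surely bounded by the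
  maximal inequality. So the square root of the wealth is almost surely
  \<open>O (exp (- \<sigma>\<^sup>2 / 16 * \<Sum> \<lambda>\<^sub>k\<^sup>2))\<close>, which tends to 0. The actual bets tend to 0 by the
  strong law, so they agree from some point on with their truncations to \<open>[- 1 / 2, 1 / 2]\<close>. The
  early factors of the wealth may be negative (when \<open>m > 1 / 2\<close>), but they only contribute a
  constant.
\<close>

section \<open>Central limit theorem for affinely rescaled sums\<close>

text \<open>Eventually \<open>x n\<close> lies within \<open>d\<close> of \<open>x0\<close>, so
  monotonicity traps \<open>F n (x n)\<close> between \<open>F n (x0 - d)\<close> and
  \<open>F n (x0 + d)\<close>, whose limits are close to \<open>G x0\<close> by continuity. This
  absorbs an asymptotically negligible change of normalisation.\<close>

lemma weak_conv_tendsto_moving_point: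
  fixes F :: "nat \<Rightarrow> real \<Rightarrow> real"
  assumes conv: "weak_conv F G" and mono: "\<And>n. mono (F n)" and cont: "\<And>y. isCont G y"
    and x: "x \<longlonglongrightarrow> x0"
  shows "(\<lambda>n. F n (x n)) \<longlonglongrightarrow> G x0"
proof (rule LIMSEQ_I)
  fix e :: real assume e: "e > 0"
  obtain s where s: "s > 0" "\<And>y. \<bar>y - x0\<bar> < s \<Longrightarrow> \<bar>G y - G x0\<bar> < e / 2"
    using cont[of x0, unfolded continuous_at_eps_delta, rule_format, of "e / 2"] e
    by (auto simp: dist_real_def)
  define d where "d = s / 2"
  have d: "d > 0" "\<bar>G (x0 + d) - G x0\<bar> < e / 2" "\<bar>G (x0 - d) - G x0\<bar> < e / 2"
    using s by (auto simp: d_def)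
  have lim: "(\<lambda>n. F n y) \<longlonglongrightarrow> G y" for y
    using conv cont by (auto simp: weak_conv_def)
  have "\<forall>\<^sub>F n in sequentially. dist (x n) x0 < d"
    using x d by (auto intro: tendstoD)
  moreover have "\<forall>\<^sub>F n in sequentially. dist (F n (x0 + d)) (G (x0 + d)) < e / 2"
    using lim e by (intro tendstoD) auto
  moreover have "\<forall>\<^sub>F n in sequentially. dist (F n (x0 - d)) (G (x0 - d)) < e / 2"
    using lim e by (intro tendstoD) auto
  ultimately have "\<forall>\<^sub>F n in sequentially. norm (F n (x n) - G x0) < e"
  proof eventually_elim
    case (elim n)
    have "F n (x0 - d) \<le> F n (x n)" "F n (x n) \<le> F n (x0 + d)"
      using elim(1) by (auto intro!: monoD[OF mono] simp: dist_real_def)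
    then show ?case
      using elim d by (auto simp: dist_real_def abs_if split: if_splits)
  qed
  then show "\<exists>n0. \<forall>n\<ge>n0. norm (F n (x n) - G x0) < e"
    by (simp add: eventually_sequentially)
qed

lemma (in prob_space) cdf_distr:
  assumes "random_variable borel X"
  shows "cdf (distr M borel X) x = prob {\<omega> \<in> space M. X \<omega> \<le> x}"
  using assms by (auto simp: cdf_def measure_distr intro!: arg_cong[where f = prob])

lemma real_distribution_normal:
  assumes "s > 0"
  shows "real_distribution (density lborel (normal_density \<mu> s))"
  using prob_space_normal_density[OF assms]
  by (auto simp: real_distribution_def real_distribution_axioms_def)

text \<open>A law with a Lebesgue density gives no mass to points, and a cdf is continuous exactly
  where there is no atom.\<close>

lemma isCont_cdf_normal:
  assumes "s > 0"
  shows "isCont (cdf (density lborel (normal_density \<mu> s))) x"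
proof -
  interpret real_distribution "density lborel (normal_density \<mu> s)"
    by (rule real_distribution_normal[OF assms])
  have "AE y in lborel. y \<in> {x} \<longrightarrow> ennreal (normal_density \<mu> s y) = 0"
    using AE_lborel_singleton[of x] by eventually_elim simp
  then have "{x} \<in> null_sets (density lborel (normal_density \<mu> s))"
    by (subst null_sets_density_iff) simp_all
  then show ?thesis
    by (simp add: isCont_cdf measure_def null_setsD1)
qed

lemma cdf_normal_scale:
  assumes "s > 0"
  shows "cdf (density lborel (normal_density 0 s)) x = cdf std_normal_distribution (x / s)"
proof -
  interpret real_distribution std_normal_distribution
    by (rule real_dist_normal_dist)
  have "distributed std_normal_distribution lborel (\<lambda>x. x) std_normal_density"
    by (auto simp: distributed_def distr_id2 cong: distr_cong)
  from normal_density_affine[OF this, of s 0]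
  have "distributed std_normal_distribution lborel (\<lambda>x. s * x) (normal_density 0 s)"
    using assms by simp
  then have "density lborel (normal_density 0 s) = distr std_normal_distribution lborel (\<lambda>x. s * x)"
    by (simp add: distributed_def)
  also have "cdf \<dots> x = measure std_normal_distribution {y. s * y \<le> x}"
    by (simp add: cdf_def measure_distr vimage_def)
  also have "{y. s * y \<le> x} = {..x / s}"
    using assms by (auto simp: field_simps)
  finally show ?thesis
    by (simp add: cdf_def)
qed

text \<open>Solving the inequality \<open>(b + z) / (c * sqrt (real (Suc n))) \<le> x\<close> for
  \<open>z / sqrt (real n * s\<^sup>2)\<close> turns the cdf into that of the classically normalised
  sum at the moving point \<open>y x n\<close>, which tends to \<open>x * c / s\<close>. The root of
  \<open>Suc n\<close> over a sum of \<open>n\<close> terms fits bet number \<open>n + 1\<close>,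
  which has seen \<open>n\<close> outcomes.\<close>

lemma (in prob_space) central_limit_theorem_affine:
  fixes X :: "nat \<Rightarrow> 'a \<Rightarrow> real"
  assumes indep: "indep_vars (\<lambda>i. borel) X UNIV"
    and mean: "\<And>n. expectation (X n) = 0"
    and s: "s > 0"
    and sq: "\<And>n. integrable M (\<lambda>x. (X n x)\<^sup>2)"
    and var: "\<And>n. variance (X n) = s\<^sup>2"
    and distr: "\<And>n. distr M borel (X n) = \<mu>"
    and c: "c > 0"
  shows "weak_conv_m (\<lambda>n. distr M borel (\<lambda>\<omega>. (b + (\<Sum>i<n. X i \<omega>)) / (c * sqrt (real (Suc n)))))
    (density lborel (normal_density 0 (s / c)))"
proof -
  have [measurable]: "random_variable borel (X n)" for n
    using indep by (simp add: indep_vars_def2)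
  define F where "F n = cdf (distr M borel (\<lambda>\<omega>. (\<Sum>i<n. X i \<omega>) / sqrt (n * s\<^sup>2)))" for n
  define y where "y x n = (x * c * sqrt (real (Suc n)) - b) / sqrt (real n * s\<^sup>2)" for x n
  have sc: "s / c > 0"
    using s c by simp
  \<comment> \<open>At \<open>n = 0\<close> the classical normalisation is 0, so the identity is
    claimed for positive \<open>n\<close> only, which is enough for the limit.\<close>
  have F_eq: "F n (y x n) =
      cdf (distr M borel (\<lambda>\<omega>. (b + (\<Sum>i<n. X i \<omega>)) / (c * sqrt (real (Suc n))))) x"
    if "n > 0" for n x
  proof -
    have "sqrt (real n * s\<^sup>2) > 0" "c * sqrt (real (Suc n)) > 0"
      using that s c by auto
    then have "z / sqrt (real n * s\<^sup>2) \<le> y x n \<longleftrightarrow> (b + z) / (c * sqrt (real (Suc n))) \<le> x" for z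
      unfolding y_def by (subst divide_le_cancel, subst pos_divide_le_eq) (auto simp: algebra_simps)
    then show ?thesis
      unfolding F_def by (simp add: cdf_distr)
  qed
  have lim: "(\<lambda>n. F n (y x n)) \<longlonglongrightarrow> cdf std_normal_distribution (x / (s / c))" for x
  proof (rule weak_conv_tendsto_moving_point[where F = F and x = "y x" and
        G = "cdf std_normal_distribution" and ?x0.0 = "x / (s / c)"])
    show "weak_conv F (cdf std_normal_distribution)"
      using central_limit_theorem_zero_mean[OF indep mean s sq var distr]
      by (simp add: weak_conv_m_def F_def [abs_def])
    show "mono (F n)" for n
    proof -
      interpret D: real_distribution "distr M borel (\<lambda>\<omega>. (\<Sum>i<n. X i \<omega>) / sqrt (n * s\<^sup>2))"
        by simp
      show ?thesis
        unfolding F_def by (intro monoI D.cdf_nondecreasing)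
    qed
    show "isCont (cdf std_normal_distribution) z" for z
      by (rule isCont_cdf_normal) simp
    have "(\<lambda>n. sqrt (real (Suc n)) / sqrt (real n)) \<longlonglongrightarrow> 1"
      and "(\<lambda>n. 1 / sqrt (real n)) \<longlonglongrightarrow> 0"
      by real_asymp+
    then have "(\<lambda>n. x * c / s * (sqrt (real (Suc n)) / sqrt (real n)) - b / s * (1 / sqrt (real n)))
        \<longlonglongrightarrow> x * c / s * 1 - b / s * 0"
      by (intro tendsto_diff tendsto_mult_left)
    then show "y x \<longlonglongrightarrow> x / (s / c)"
      using s by (simp add: y_def [abs_def] real_sqrt_mult diff_divide_distrib mult.commute)
  qed
  have "(\<lambda>n. cdf (distr M borel (\<lambda>\<omega>. (b + (\<Sum>i<n. X i \<omega>)) / (c * sqrt (real (Suc n))))) x)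
      \<longlonglongrightarrow> cdf (density lborel (normal_density 0 (s / c))) x" for x
    unfolding cdf_normal_scale[OF sc]
    by (rule Lim_transform_eventually[OF lim])
      (auto intro: eventually_mono[OF eventually_gt_at_top[of 0]] simp: F_eq)
  then show ?thesis
    by (simp add: weak_conv_m_def weak_conv_def)
qed

section \<open>Order in probability and divergence of the sum of squares\<close>

text \<open>Since the limit law has no atom at 0, some interval around 0 has limiting mass below
  \<epsilon>. Weak convergence passes this bound on to the rescaled variables for all large
  \<open>n\<close>, and half the length of the interval serves as \<delta>.\<close>

lemma (in prob_space) Omega_p_if_weak_conv:
  assumes [measurable]: "\<And>n. random_variable borel (Y n)"
    and a: "\<forall>\<^sub>F n in sequentially. a n > 0"
    and conv: "weak_conv_m (\<lambda>n. distr M borel (\<lambda>\<omega>. Y n \<omega> / a n)) \<mu>"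
    and cont: "\<And>x. isCont (cdf \<mu>) x"
  shows "Omega_p M Y a"
  unfolding Omega_p_def
proof (intro allI impI)
  fix \<epsilon> :: real assume \<epsilon>: "\<epsilon> > 0"
  define F where "F n = cdf (distr M borel (\<lambda>\<omega>. Y n \<omega> / a n))" for n
  have "((\<lambda>d. cdf \<mu> d - cdf \<mu> (- d)) \<longlongrightarrow> cdf \<mu> 0 - cdf \<mu> (- 0)) (at_right 0)"
    by (intro tendsto_intros isCont_tendsto_compose[OF cont])
  then have "\<forall>\<^sub>F d in at_right 0. cdf \<mu> d - cdf \<mu> (- d) < \<epsilon>"
    using \<epsilon> by (intro order_tendstoD(2)) auto
  moreover have "\<forall>\<^sub>F d in at_right (0::real). d > 0"
    by (simp add: eventually_at_right_less)
  ultimately have "\<forall>\<^sub>F d in at_right 0. d > 0 \<and> cdf \<mu> d - cdf \<mu> (- d) < \<epsilon>"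
    by eventually_elim auto
  then obtain d where d: "d > 0" "cdf \<mu> d - cdf \<mu> (- d) < \<epsilon>"
    using eventually_happens'[of "at_right (0::real)"] by auto
  have "(\<lambda>n. F n d - F n (- d)) \<longlonglongrightarrow> cdf \<mu> d - cdf \<mu> (- d)"
    using conv cont by (intro tendsto_diff) (auto simp: F_def weak_conv_m_def weak_conv_def)
  then have "\<forall>\<^sub>F n in sequentially. F n d - F n (- d) < \<epsilon>"
    using d by (intro order_tendstoD(2)) auto
  with a have "\<forall>\<^sub>F n in sequentially. prob {\<omega> \<in> space M. \<bar>Y n \<omega>\<bar> \<ge> d * a n} \<ge> 1 - \<epsilon>"
  proof eventually_elim
    case (elim n)
    interpret D: real_distribution "distr M borel (\<lambda>\<omega>. Y n \<omega> / a n)"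
      by simp
    have "1 - prob {\<omega> \<in> space M. \<bar>Y n \<omega>\<bar> \<ge> d * a n} = prob {\<omega> \<in> space M. \<not> \<bar>Y n \<omega>\<bar> \<ge> d * a n}"
      by (rule prob_neg [symmetric]) measurable
    \<comment> \<open>The open interval is enlarged to a half-open one, whose mass is a difference
      of two cdf values.\<close>
    also have "\<dots> \<le> prob {\<omega> \<in> space M. Y n \<omega> / a n \<in> {- d <.. d}}"
      using elim by (intro finite_measure_mono) (auto simp: field_simps)
    also have "\<dots> = measure (distr M borel (\<lambda>\<omega>. Y n \<omega> / a n)) {- d <.. d}"
      by (subst measure_distr) (auto intro!: arg_cong[where f = prob])
    also have "\<dots> = F n d - F n (- d)"
      using d by (simp add: F_def D.cdf_diff_eq)
    finally show ?case
      using elim by simp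
  qed
  then show "\<exists>\<delta>>0. \<forall>\<^sub>F n in sequentially. 1 - \<epsilon> \<le> prob {\<omega> \<in> space M. \<delta> * a n \<le> \<bar>Y n \<omega>\<bar>}"
    using d by blast
qed

text \<open>If the squares had bounded partial sums with positive probability, then each late
  \<open>Y n\<close> would still be large on a fixed fraction of that event. Integrating the partial
  sums over the event would bound a multiple of the harmonic series.\<close>

lemma (in prob_space) AE_not_summable_square_if_Omega_p:
  assumes [measurable]: "\<And>n. random_variable borel (Y n)"
    and omega: "Omega_p M Y (\<lambda>n. real n powr (- 1 / 2))"
  shows "AE \<omega> in M. \<not> summable (\<lambda>n. (Y n \<omega>)\<^sup>2)"
proof -
  \<comment> \<open>Summability at a point places it in some \<open>A K\<close>, so it suffices that
    each of these countably many events is null.\<close>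
  define A where "A K = {\<omega> \<in> space M. \<forall>n. (\<Sum>k<n. (Y k \<omega>)\<^sup>2) \<le> real K}" for K
  have A[measurable]: "A K \<in> events" for K
    unfolding A_def by measurable
  have "prob (A K) = 0" for K
  proof (rule ccontr)
    assume "prob (A K) \<noteq> 0"
    then have p: "prob (A K) > 0"
      by (simp add: zero_less_measure_iff)
    \<comment> \<open>The tolerance is half of \<open>prob (A K)\<close>, so that the event of a
      large \<open>Y n\<close> must overlap \<open>A K\<close> in probability at least
      \<open>prob (A K) / 2\<close>.\<close>
    then obtain \<delta> N where \<delta>: "\<delta> > 0" and
      "\<And>n. n \<ge> N \<Longrightarrow> prob {\<omega> \<in> space M. \<bar>Y n \<omega>\<bar> \<ge> \<delta> * real n powr (- 1 / 2)} \<ge> 1 - prob (A K) / 2"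
      using omega unfolding Omega_p_def eventually_sequentially
      by (meson half_gt_zero)
    then have N: "prob {\<omega> \<in> space M. \<bar>Y n \<omega>\<bar> \<ge> \<delta> * real n powr (- 1 / 2)} \<ge> 1 - prob (A K) / 2"
      if "n \<ge> N" for n using that by blast
    define B where "B n = A K \<inter> {\<omega> \<in> space M. \<bar>Y n \<omega>\<bar> \<ge> \<delta> * real n powr (- 1 / 2)}" for n
    have B[measurable]: "B n \<in> events" for n
      unfolding B_def by measurable
    have pB: "prob (B n) \<ge> prob (A K) / 2" if "n \<ge> N" for n
    proof -
      let ?E = "{\<omega> \<in> space M. \<bar>Y n \<omega>\<bar> \<ge> \<delta> * real n powr (- 1 / 2)}"
      have "prob (A K) \<le> prob (B n \<union> (space M - ?E))"
        using sets.sets_into_space[OF A] by (intro finite_measure_mono) (auto simp: B_def)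
      also have "\<dots> \<le> prob (B n) + prob (space M - ?E)"
        by (intro measure_Un_le) measurable
      also have "prob (space M - ?E) = 1 - prob ?E"
        by (rule prob_compl) measurable
      finally show ?thesis
        using N[OF that] by simp
    qed
    have "(\<Sum>k<n. \<delta>\<^sup>2 / real k * prob (B k)) \<le> real K" for n
    proof -
      \<comment> \<open>On \<open>A K\<close> each term is at most the corresponding square, and off
        \<open>A K\<close> both sides vanish. The index 0 contributes nothing, since both division
        by 0 and \<open>0 powr (- 1 / 2)\<close> give 0.\<close>
      have *: "(\<Sum>k<n. \<delta>\<^sup>2 / real k * indicator (B k) \<omega>) \<le> real K * indicator (A K) \<omega>"
        if "\<omega> \<in> space M" for \<omega>
      proof (cases "\<omega> \<in> A K")
        case True
        have "\<delta>\<^sup>2 / real k * indicator (B k) \<omega> \<le> (Y k \<omega>)\<^sup>2" for k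
        proof (cases "\<omega> \<in> B k")
          case True
          then have "(\<delta> * real k powr (- 1 / 2))\<^sup>2 \<le> \<bar>Y k \<omega>\<bar>\<^sup>2"
            using \<delta> by (intro power_mono) (auto simp: B_def)
          moreover have "(real k powr (- 1 / 2))\<^sup>2 = 1 / real k"
            by (cases "k = 0")
              (auto simp: powr_minus powr_half_sqrt power_inverse inverse_eq_divide power_divide)
          ultimately show ?thesis
            using True by (simp add: power_mult_distrib)
        qed simp
        then have "(\<Sum>k<n. \<delta>\<^sup>2 / real k * indicator (B k) \<omega>) \<le> (\<Sum>k<n. (Y k \<omega>)\<^sup>2)"
          by (rule sum_mono)
        also have "\<dots> \<le> real K"
          using True by (simp add: A_def)
        finally show ?thesis
          using True by simp
      next
        case False
        then show ?thesis
          by (simp add: B_def)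
      qed
      have int: "integrable M (\<lambda>\<omega>. \<delta>\<^sup>2 / real k * indicator (B k) \<omega>)" for k
        by (intro integrable_mult_right integrable_real_indicator) (auto simp: emeasure_eq_measure)
      have "(\<Sum>k<n. \<delta>\<^sup>2 / real k * prob (B k)) =
          expectation (\<lambda>\<omega>. \<Sum>k<n. \<delta>\<^sup>2 / real k * indicator (B k) \<omega>)"
        by (subst Bochner_Integration.integral_sum[OF int]) simp
      also have "\<dots> \<le> expectation (\<lambda>\<omega>. real K * indicator (A K) \<omega>)"
        using * by (intro integral_mono Bochner_Integration.integrable_sum int integrable_mult_right
            integrable_real_indicator) (auto simp: emeasure_eq_measure)
      also have "\<dots> \<le> real K"
        by (simp add: mult_left_le)
      finally show ?thesis .
    qed
    then have "summable (\<lambda>k. \<delta>\<^sup>2 / real k * prob (B k))"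
      by (intro summableI_nonneg_bounded[where x = "real K"]) auto
    \<comment> \<open>From \<open>N\<close> on, \<open>prob (B k)\<close> is at least
      \<open>prob (A K) / 2\<close>, so the summable series dominates a positive multiple of the
      harmonic series.\<close>
    then have "summable (\<lambda>k. \<delta>\<^sup>2 * (prob (A K) / 2) * inverse (real k))"
    proof (rule summable_comparison_test_ev[rotated])
      show "\<forall>\<^sub>F k in sequentially. norm (\<delta>\<^sup>2 * (prob (A K) / 2) * inverse (real k))
          \<le> \<delta>\<^sup>2 / real k * prob (B k)"
        using eventually_ge_at_top[of N]
      proof eventually_elim
        case (elim k)
        have "\<delta>\<^sup>2 / real k * (prob (A K) / 2) \<le> \<delta>\<^sup>2 / real k * prob (B k)"
          by (intro mult_left_mono pB elim) simp
        then show ?case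
          by (simp add: field_simps)
      qed
    qed
    then have "summable (\<lambda>k. inverse (real k))"
      using \<delta> p by (subst (asm) summable_cmult_iff) auto
    then show False
      using not_summable_harmonic[where 'a = real] by simp
  qed
  then have "AE \<omega> in M. \<omega> \<notin> A K" for K
    by (subst AE_iff_measurable[OF A]) (auto simp: emeasure_eq_measure dest: sets.sets_into_space[OF A, THEN subsetD])
  then have "AE \<omega> in M. \<forall>K. \<omega> \<notin> A K"
    by (simp add: AE_all_countable)
  then show ?thesis
    using AE_space
  proof eventually_elim
    case (elim \<omega>)
    show ?case
    proof
      assume s: "summable (\<lambda>n. (Y n \<omega>)\<^sup>2)"
      obtain K :: nat where "(\<Sum>n. (Y n \<omega>)\<^sup>2) \<le> real K"
        using real_arch_simple by blast
      moreover have "(\<Sum>k<n. (Y k \<omega>)\<^sup>2) \<le> (\<Sum>n. (Y n \<omega>)\<^sup>2)" for n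
        by (rule sum_le_suminf[OF s]) auto
      ultimately have "\<forall>n. (\<Sum>k<n. (Y k \<omega>)\<^sup>2) \<le> real K"
        by (meson order_trans)
      then have "\<omega> \<in> A K"
        using elim by (simp add: A_def)
      then show False
        using elim by blast
    qed
  qed
qed

section \<open>The history of an independent sequence\<close>

text \<open>The product formula over \<open>f\<close> applied to a finite index set is pulled back
  along the inverse of \<open>f\<close>. It serves to shift a sequence indexed from 1 to one indexed
  from 0.\<close>

lemma (in prob_space) indep_vars_reindex:
  assumes "indep_vars M' X I" "inj_on f J" "f ` J \<subseteq> I"
  shows "indep_vars (\<lambda>j. M' (f j)) (\<lambda>j. X (f j)) J"
proof -
  have "indep_sets (\<lambda>j. {X (f j) -` A \<inter> space M |A. A \<in> sets (M' (f j))}) J"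
    unfolding indep_sets_def
  proof (intro conjI ballI allI impI)
    have *: "indep_sets (\<lambda>i. {X i -` A \<inter> space M |A. A \<in> sets (M' i)}) I"
      using assms by (simp add: indep_vars_def2)
    then show "{X (f j) -` A \<inter> space M |A. A \<in> sets (M' (f j))} \<subseteq> events" if "j \<in> J" for j
      using assms that by (auto simp: indep_sets_def)
    fix K A
    assume K: "K \<subseteq> J" "K \<noteq> {}" "finite K"
      and A: "A \<in> (\<Pi> j\<in>K. {X (f j) -` A \<inter> space M |A. A \<in> sets (M' (f j))})"
    have inj: "inj_on f K"
      using assms K by (auto intro: inj_on_subset)
    have "prob (\<Inter>i\<in>f ` K. A (inv_into K f i)) = (\<Prod>i\<in>f ` K. prob (A (inv_into K f i)))"
    proof (rule indep_setsD[OF *])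
      show "\<forall>i\<in>f ` K. A (inv_into K f i) \<in> {X i -` A \<inter> space M |A. A \<in> sets (M' i)}"
        using A by (auto simp: inv_into_f_f[OF inj] Pi_iff)
    qed (use K assms in auto)
    then show "prob (\<Inter>j\<in>K. A j) = (\<Prod>j\<in>K. prob (A j))"
      by (simp add: prod.reindex[OF inj] inv_into_f_f[OF inj])
  qed
  then show ?thesis
    using assms by (auto simp: indep_vars_def2)
qed

text \<open>This is the strict past of index \<open>n\<close>, generated by the variables with index
  below \<open>n\<close>. As a pullback along one tuple map its events are exactly the preimages
  under that map, the form in which independence of tuples is available.\<close>

definition history :: "'a measure \<Rightarrow> (nat \<Rightarrow> 'a \<Rightarrow> real) \<Rightarrow> nat \<Rightarrow> 'a measure" where
  "history M \<xi> n =
     vimage_algebra (space M) (\<lambda>\<omega>. \<lambda>i\<in>{..<n}. \<xi> i \<omega>) (PiM {..<n} (\<lambda>_. borel))"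

lemma space_history[simp]: "space (history M \<xi> n) = space M"
  by (simp add: history_def)

lemma sets_history:
  "sets (history M \<xi> n) =
     {(\<lambda>\<omega>. \<lambda>i\<in>{..<n}. \<xi> i \<omega>) -` A \<inter> space M | A. A \<in> sets (PiM {..<n} (\<lambda>_. borel))}"
  unfolding history_def by (rule sets_vimage_algebra2) (auto simp: space_PiM)

lemma measurable_history[measurable (raw)]:
  assumes "i < n"
  shows "\<xi> i \<in> borel_measurable (history M \<xi> n)"
proof -
  have "(\<lambda>\<omega>. \<lambda>i\<in>{..<n}. \<xi> i \<omega>) \<in> measurable (history M \<xi> n) (PiM {..<n} (\<lambda>_. borel))"
    unfolding history_def by (rule measurable_vimage_algebra1) (auto simp: space_PiM)
  moreover have "(\<lambda>x. x i) \<in> borel_measurable (PiM {..<n} (\<lambda>_. borel))"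
    using assms by (intro measurable_component_singleton) simp
  ultimately have "(\<lambda>\<omega>. (\<lambda>i\<in>{..<n}. \<xi> i \<omega>) i) \<in> borel_measurable (history M \<xi> n)"
    by (rule measurable_compose)
  then show ?thesis
    using assms by (simp only: restrict_apply lessThan_iff if_True)
qed

text \<open>Taking \<open>N\<close> to be \<open>M\<close> shows that the history consists of
  events; taking \<open>N\<close> to be a later history shows that histories increase.\<close>

lemma subalgebra_history:
  assumes "\<And>i. i < n \<Longrightarrow> \<xi> i \<in> borel_measurable N" "space N = space M"
  shows "subalgebra N (history M \<xi> n)"
proof -
  have *: "(\<lambda>\<omega>. \<lambda>i\<in>{..<n}. \<xi> i \<omega>) \<in> measurable N (PiM {..<n} (\<lambda>_. borel))"
    using assms by (intro measurable_restrict) auto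
  show ?thesis
    unfolding subalgebra_def sets_history
    using measurable_sets[OF *] assms by auto
qed

text \<open>The tuple of the first \<open>n\<close> variables and the one-element tuple at
  \<open>n\<close> use disjoint indices, hence are independent. The events of \<open>f\<close> and
  of \<open>\<xi> n\<close> lie in the two generated sigma-algebras, and independence passes to
  subfamilies.\<close>

lemma (in prob_space) indep_var_history:
  assumes indep: "indep_vars (\<lambda>_. borel) \<xi> UNIV"
    and f: "f \<in> borel_measurable (history M \<xi> n)"
  shows "indep_var borel f borel (\<xi> n)"
proof -
  have [measurable]: "random_variable borel (\<xi> i)" for i
    using indep by (simp add: indep_vars_def2)
  let ?T = "\<lambda>\<omega>. \<lambda>i\<in>{..<n}. \<xi> i \<omega>"
  have sub: "subalgebra M (history M \<xi> n)"
    by (intro subalgebra_history) auto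
  let ?R = "\<lambda>\<omega>. \<lambda>i\<in>{n}. \<xi> i \<omega>"
  let ?P = "\<lambda>A. PiM A (\<lambda>_. borel :: real measure)"
  have "indep_var (?P {..<n}) ?T (?P {n}) ?R"
    by (rule indep_var_restrict[OF indep]) auto
  then have "indep_set (sigma_sets (space M) {?T -` A \<inter> space M |A. A \<in> sets (?P {..<n})})
      (sigma_sets (space M) {?R -` A \<inter> space M |A. A \<in> sets (?P {n})})"
    by (simp add: indep_var_eq)
  moreover have "sigma_sets (space M) {f -` A \<inter> space M |A. A \<in> sets borel} \<subseteq>
      sigma_sets (space M) {?T -` A \<inter> space M |A. A \<in> sets (?P {..<n})}"
    unfolding sets_history[symmetric]
    using measurable_sets[OF f] by (intro sigma_sets_mono') auto
  moreover have "sigma_sets (space M) {\<xi> n -` A \<inter> space M |A. A \<in> sets borel} \<subseteq>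
      sigma_sets (space M) {?R -` A \<inter> space M |A. A \<in> sets (?P {n})}"
  proof (intro sigma_sets_mono' subsetI)
    fix B assume "B \<in> {\<xi> n -` A \<inter> space M |A. A \<in> sets borel}"
    then obtain A where A: "B = \<xi> n -` A \<inter> space M" "A \<in> sets borel"
      by auto
    have "(\<lambda>x. x n) -` A \<inter> space (?P {n}) \<in> sets (?P {n})"
      using A(2) by (intro measurable_sets[OF measurable_component_singleton]) auto
    moreover have "B = ?R -` ((\<lambda>x. x n) -` A \<inter> space (?P {n})) \<inter> space M"
      using A(1) by (auto simp: space_PiM)
    ultimately show "B \<in> {?R -` A \<inter> space M |A. A \<in> sets (?P {n})}"
      by blast
  qed
  ultimately have "indep_set (sigma_sets (space M) {f -` A \<inter> space M |A. A \<in> sets borel})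
      (sigma_sets (space M) {\<xi> n -` A \<inter> space M |A. A \<in> sets borel})"
    unfolding indep_set_def by (elim indep_sets_mono_sets) (auto split: bool.split)
  then show ?thesis
    using measurable_from_subalg[OF sub f] by (auto simp: indep_var_eq)
qed

section \<open>Nonnegative supermartingales\<close>

text \<open>\<open>S n\<close> is the event that level \<open>a\<close> has not been reached by time
  \<open>n\<close>. Keeping the integral of \<open>V n\<close> over \<open>S n\<close> on the left
  makes the bound inductive. The supermartingale property is phrased by integrals over past events,
  which avoids conditional expectations.\<close>

lemma (in finite_measure) supermartingale_maximal_inequality:
  fixes V :: "nat \<Rightarrow> 'a \<Rightarrow> real" and F :: "nat \<Rightarrow> 'a measure"
  assumes sub: "\<And>n. subalgebra M (F n)" "\<And>m n. m \<le> n \<Longrightarrow> subalgebra (F n) (F m)"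
    and V: "\<And>n. V n \<in> borel_measurable (F n)" "\<And>n. integrable M (V n)"
      "\<And>n \<omega>. \<omega> \<in> space M \<Longrightarrow> 0 \<le> V n \<omega>"
    and super: "\<And>n A. A \<in> sets (F n) \<Longrightarrow> (LINT \<omega>:A|M. V (Suc n) \<omega>) \<le> (LINT \<omega>:A|M. V n \<omega>)"
  shows "a * measure M {\<omega> \<in> space M. \<exists>j\<le>n. a \<le> V j \<omega>} \<le> (LINT \<omega>|M. V 0 \<omega>)"
proof -
  define S where "S n = {\<omega> \<in> space M. \<forall>j\<le>n. V j \<omega> < a}" for n
  have VF: "V m \<in> borel_measurable (F n)" if "m \<le> n" for m n
    using V(1) sub(2)[OF that] by (rule measurable_from_subalg[rotated])
  have VM[measurable]: "V m \<in> borel_measurable M" for m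
    using V(2) by blast
  have SM[measurable]: "S n \<in> sets M" for n
    unfolding S_def by measurable
  have SF: "S n \<in> sets (F n)" for n
  proof -
    have "S n = {\<omega> \<in> space (F n). \<forall>j\<in>{..n}. V j \<omega> < a}"
      using sub(1)[of n] by (auto simp: S_def subalgebra_def)
    also have "\<dots> \<in> sets (F n)"
      by (intro sets.sets_Collect_finite_All borel_measurable_less VF) auto
    finally show ?thesis .
  qed
  have int: "set_integrable M A (V n)" if "A \<in> sets M" for A n
    using that V(2) unfolding set_integrable_def by (intro integrable_mult_indicator) auto
  have bound: "a * measure M A \<le> (LINT \<omega>:A|M. V n \<omega>)"
    if A: "A \<in> sets M" "\<And>\<omega>. \<omega> \<in> A \<Longrightarrow> a \<le> V n \<omega>" for A n
  proof -
    have "a * measure M A = (LINT \<omega>:A|M. a)"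
      using A by (simp add: set_integral_const emeasure_eq_measure)
    also have "\<dots> \<le> (LINT \<omega>:A|M. V n \<omega>)"
      using A by (intro set_integral_mono int) (auto simp: set_integrable_def emeasure_eq_measure)
    finally show ?thesis .
  qed
  have "a * measure M {\<omega> \<in> space M. \<exists>j\<le>n. a \<le> V j \<omega>} + (LINT \<omega>:S n|M. V n \<omega>) \<le> (LINT \<omega>|M. V 0 \<omega>)"
  proof (induction n)
    case 0
    let ?A = "{\<omega> \<in> space M. a \<le> V 0 \<omega>}"
    have A: "?A \<in> sets M"
      by measurable
    have "(LINT \<omega>|M. V 0 \<omega>) = (LINT \<omega>:?A \<union> S 0|M. V 0 \<omega>)"
      by (subst set_integral_space[symmetric, OF V(2)])
        (rule arg_cong[where f = "\<lambda>A. set_lebesgue_integral M A (V 0)"], auto simp: S_def)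
    moreover have "\<dots> = (LINT \<omega>:?A|M. V 0 \<omega>) + (LINT \<omega>:S 0|M. V 0 \<omega>)"
      by (intro set_integral_Un int A SM) (auto simp: S_def)
    moreover have "a * measure M ?A \<le> (LINT \<omega>:?A|M. V 0 \<omega>)"
      by (rule bound[OF A]) simp
    moreover have "measure M {\<omega> \<in> space M. \<exists>j\<le>0. a \<le> V j \<omega>} = measure M ?A"
      by simp
    ultimately show ?case
      by simp
  next
    case (Suc n)
    let ?B = "{\<omega> \<in> space M. \<exists>j\<le>n. a \<le> V j \<omega>}"
    let ?A = "S n \<inter> {\<omega> \<in> space M. a \<le> V (Suc n) \<omega>}"
    have A: "?A \<in> sets M"
      by (intro sets.Int SM) measurable
    \<comment> \<open>A path below \<open>a\<close> up to time \<open>n\<close> either reaches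
      \<open>a\<close> at the next step or stays below. The supermartingale property on
      \<open>S n\<close> pays for both pieces.\<close>
    have "S n = ?A \<union> S (Suc n)"
      by (auto simp: S_def le_Suc_eq)
    then have "(LINT \<omega>:S n|M. V (Suc n) \<omega>) = (LINT \<omega>:?A \<union> S (Suc n)|M. V (Suc n) \<omega>)"
      by (rule arg_cong)
    also have "\<dots> = (LINT \<omega>:?A|M. V (Suc n) \<omega>) + (LINT \<omega>:S (Suc n)|M. V (Suc n) \<omega>)"
      by (intro set_integral_Un int A SM) (auto simp: S_def)
    finally have split: "(LINT \<omega>:S n|M. V (Suc n) \<omega>) =
        (LINT \<omega>:?A|M. V (Suc n) \<omega>) + (LINT \<omega>:S (Suc n)|M. V (Suc n) \<omega>)" .
    have le: "a * measure M ?A \<le> (LINT \<omega>:?A|M. V (Suc n) \<omega>)"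
      by (rule bound[OF A]) simp
    have "{\<omega> \<in> space M. \<exists>j\<le>Suc n. a \<le> V j \<omega>} = ?B \<union> ?A"
      by (auto simp: S_def le_Suc_eq; meson leI)
    also have "measure M \<dots> = measure M ?B + measure M ?A"
      using A by (intro finite_measure_Union) (auto simp: S_def dest: leD)
    finally have "a * measure M {\<omega> \<in> space M. \<exists>j\<le>Suc n. a \<le> V j \<omega>} =
        a * measure M ?B + a * measure M ?A"
      by (simp only: distrib_left)
    then show ?case
      using Suc split le super[OF SF, of n] by linarith
  qed
  moreover have "(LINT \<omega>:S n|M. V n \<omega>) \<ge> 0"
    unfolding set_lebesgue_integral_def
    by (intro integral_nonneg_AE AE_I2) (auto simp: V(3))
  ultimately show ?thesis
    by linarith
qed

text \<open>The maximal inequality bounds \<open>K\<close> times the probability of ever reaching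
  \<open>K\<close> by the initial mean. The set \<open>N\<close> of unbounded paths lies in all
  these events, so its measure is 0.\<close>

lemma (in finite_measure) AE_supermartingale_bounded:
  fixes V :: "nat \<Rightarrow> 'a \<Rightarrow> real" and F :: "nat \<Rightarrow> 'a measure"
  assumes sub: "\<And>n. subalgebra M (F n)" "\<And>m n. m \<le> n \<Longrightarrow> subalgebra (F n) (F m)"
    and V: "\<And>n. V n \<in> borel_measurable (F n)" "\<And>n. integrable M (V n)"
      "\<And>n \<omega>. \<omega> \<in> space M \<Longrightarrow> 0 \<le> V n \<omega>"
    and super: "\<And>n A. A \<in> sets (F n) \<Longrightarrow> (LINT \<omega>:A|M. V (Suc n) \<omega>) \<le> (LINT \<omega>:A|M. V n \<omega>)"
  shows "AE \<omega> in M. \<exists>B. \<forall>n. V n \<omega> \<le> B"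
proof -
  have [measurable]: "V m \<in> borel_measurable M" for m
    using V(2) by blast
  define N where "N = {\<omega> \<in> space M. \<forall>K. \<exists>j. real K \<le> V j \<omega>}"
  have [measurable]: "N \<in> sets M"
    unfolding N_def by measurable
  have bound: "real K * measure M {\<omega> \<in> space M. \<exists>j. real K \<le> V j \<omega>} \<le> (LINT \<omega>|M. V 0 \<omega>)" for K :: nat
  proof -
    \<comment> \<open>Continuity from below removes the finite time horizon.\<close>
    have "(\<lambda>n. measure M {\<omega> \<in> space M. \<exists>j\<le>n. real K \<le> V j \<omega>}) \<longlonglongrightarrow>
        measure M (\<Union>n. {\<omega> \<in> space M. \<exists>j\<le>n. real K \<le> V j \<omega>})"
      by (intro finite_Lim_measure_incseq) (auto simp: incseq_def intro: order_trans)
    also have "(\<Union>n. {\<omega> \<in> space M. \<exists>j\<le>n. real K \<le> V j \<omega>}) = {\<omega> \<in> space M. \<exists>j. real K \<le> V j \<omega>}"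
      by auto
    finally show ?thesis
      by (intro LIMSEQ_le_const2[OF tendsto_mult_left])
        (auto intro!: supermartingale_maximal_inequality[where F = F] assms)
  qed
  have "real K * measure M N \<le> (LINT \<omega>|M. V 0 \<omega>)" for K :: nat
  proof -
    have "measure M N \<le> measure M {\<omega> \<in> space M. \<exists>j. real K \<le> V j \<omega>}"
      by (intro finite_measure_mono) (auto simp: N_def)
    then have "real K * measure M N \<le> real K * measure M {\<omega> \<in> space M. \<exists>j. real K \<le> V j \<omega>}"
      by (intro mult_left_mono) auto
    then show ?thesis
      using bound by (rule order_trans)
  qed
  then have "\<not> measure M N > 0"
    by (metis reals_Archimedean3 not_less)
  then have "measure M N = 0"
    by (simp add: zero_less_measure_iff)
  then have "AE \<omega> in M. \<omega> \<notin> N"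
    by (intro AE_not_in) (auto simp: null_sets_def emeasure_eq_measure)
  then show ?thesis
    using AE_space
  proof eventually_elim
    case (elim \<omega>)
    then obtain K :: nat where "\<And>j. V j \<omega> < real K"
      by (auto simp: N_def not_le)
    then show ?case
      by (auto intro: less_imp_le)
  qed
qed

section \<open>Betting on a bounded independent sequence\<close>

text \<open>A quantity determined by the past is independent of \<open>\<xi> n\<close>. This stands
  in for taking out what is known from a conditional expectation.\<close>

lemma (in prob_space) expectation_history_mult:
  assumes indep: "indep_vars (\<lambda>_. borel) \<xi> UNIV"
    and f: "f \<in> borel_measurable (history M \<xi> n)" "integrable M f"
    and g: "g \<in> borel_measurable borel" "integrable M (\<lambda>\<omega>. g (\<xi> n \<omega>))"
  shows "expectation (\<lambda>\<omega>. f \<omega> * g (\<xi> n \<omega>)) = expectation f * expectation (\<lambda>\<omega>. g (\<xi> n \<omega>) :: real)"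
    and "integrable M (\<lambda>\<omega>. f \<omega> * g (\<xi> n \<omega>))"
proof -
  have "indep_var borel ((\<lambda>x. x) \<circ> f) borel (g \<circ> \<xi> n)"
    using indep_var_history[OF indep f(1)] g(1) by (intro indep_var_compose) auto
  then have "indep_var borel f borel (\<lambda>\<omega>. g (\<xi> n \<omega>))"
    by (simp add: comp_def)
  with f g show "expectation (\<lambda>\<omega>. f \<omega> * g (\<xi> n \<omega>)) = expectation f * expectation (\<lambda>\<omega>. g (\<xi> n \<omega>) :: real)"
    and "integrable M (\<lambda>\<omega>. f \<omega> * g (\<xi> n \<omega>))"
    by (auto intro: indep_var_lebesgue_integral indep_var_integrable)
qed

text \<open>The square of the right side exceeds \<open>1 + u\<close> by
  \<open>u\<^sup>2 * (1 / 8 - u / 16 + u\<^sup>2 / 256)\<close>. The coefficient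
  \<open>1 / 16\<close> is half the Taylor coefficient, and the slack absorbs the cubic
  term.\<close>

lemma sqrt_one_plus_le:
  fixes u :: real
  assumes "\<bar>u\<bar> \<le> 1 / 2"
  shows "sqrt (1 + u) \<le> 1 + u / 2 - u\<^sup>2 / 16"
proof (rule real_le_lsqrt)
  have u: "- (1 / 2) \<le> u" "u \<le> 1 / 2"
    using assms by auto
  have "u\<^sup>2 \<le> (1 / 2)\<^sup>2"
    using assms by (intro abs_le_square_iff[THEN iffD1]) auto
  then show "0 \<le> 1 + u / 2 - u\<^sup>2 / 16"
    using u by (simp add: power2_eq_square)
  have "0 \<le> u\<^sup>2 * (1 / 8 - u / 16 + u\<^sup>2 / 256)"
    using u by (intro mult_nonneg_nonneg) (auto intro!: add_nonneg_nonneg)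
  also have "\<dots> = (1 + u / 2 - u\<^sup>2 / 16)\<^sup>2 - (1 + u)"
    by (simp add: power2_eq_square algebra_simps)
  finally show "1 + u \<le> (1 + u / 2 - u\<^sup>2 / 16)\<^sup>2"
    by simp
qed

text \<open>In one step the linear term of the square root bound has mean 0, and the quadratic term
  costs \<open>v / 16\<close> times the squared bet. The exponential factor in \<open>V\<close> is
  compensated by this cost, because \<open>exp y * (1 - y) \<le> 1\<close>. Boundedness of
  \<open>V\<close> then forces the product to 0 wherever the squared bets have infinite sum.\<close>

lemma (in prob_space) AE_betting_product_tendsto_0:
  fixes \<xi> \<theta> :: "nat \<Rightarrow> 'a \<Rightarrow> real"
  assumes indep: "indep_vars (\<lambda>_. borel) \<xi> UNIV"
    and \<xi>_le: "\<And>n \<omega>. \<omega> \<in> space M \<Longrightarrow> \<bar>\<xi> n \<omega>\<bar> \<le> 1"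
    and mean: "\<And>n. expectation (\<xi> n) = 0"
    and var: "\<And>n. expectation (\<lambda>\<omega>. (\<xi> n \<omega>)\<^sup>2) = v" and v: "v > 0"
    and \<theta>: "\<And>n. \<theta> n \<in> borel_measurable (history M \<xi> n)"
    and \<theta>_le: "\<And>n \<omega>. \<omega> \<in> space M \<Longrightarrow> \<bar>\<theta> n \<omega>\<bar> \<le> 1 / 2"
  shows "AE \<omega> in M. \<not> summable (\<lambda>n. (\<theta> n \<omega>)\<^sup>2) \<longrightarrow> (\<lambda>n. \<Prod>k<n. 1 + \<theta> k \<omega> * \<xi> k \<omega>) \<longlonglongrightarrow> 0"
proof -
  have \<xi>_meas[measurable]: "random_variable borel (\<xi> n)" for n
    using indep by (simp add: indep_vars_def2)
  have sub: "subalgebra M (history M \<xi> n)" for n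
    by (intro subalgebra_history) auto
  have sub': "subalgebra (history M \<xi> n) (history M \<xi> m)" if "m \<le> n" for m n
    using that by (intro subalgebra_history measurable_history) auto
  have \<theta>': "\<theta> k \<in> borel_measurable (history M \<xi> n)" if "k \<le> n" for k n
    by (rule measurable_from_subalg[OF sub'[OF that] \<theta>])
  have \<theta>_meas[measurable]: "random_variable borel (\<theta> n)" for n
    by (rule measurable_from_subalg[OF sub \<theta>])
  have prod_le: "\<bar>\<theta> n \<omega> * \<xi> n \<omega>\<bar> \<le> 1 / 2" if "\<omega> \<in> space M" for n \<omega>
    using mult_mono[OF \<theta>_le[OF that] \<xi>_le[OF that], of n n] by (simp add: abs_mult)
  have sqrt_le: "sqrt (1 + \<theta> n \<omega> * \<xi> n \<omega>) \<le> 2" "0 \<le> 1 + \<theta> n \<omega> * \<xi> n \<omega>"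
    if "\<omega> \<in> space M" for n \<omega>
  proof -
    have "- (1 / 2) \<le> \<theta> n \<omega> * \<xi> n \<omega>" "\<theta> n \<omega> * \<xi> n \<omega> \<le> 1 / 2"
      using prod_le[OF that, of n] by linarith+
    then show "sqrt (1 + \<theta> n \<omega> * \<xi> n \<omega>) \<le> 2" "0 \<le> 1 + \<theta> n \<omega> * \<xi> n \<omega>"
      by (auto intro!: real_le_lsqrt)
  qed
  have \<theta>sq_le: "(\<theta> n \<omega>)\<^sup>2 \<le> 1" if "\<omega> \<in> space M" for n \<omega>
    using \<theta>_le[OF that, of n] by (simp add: abs_square_le_1)
  define f where "f k \<omega> = sqrt (1 + \<theta> k \<omega> * \<xi> k \<omega>) * exp (v / 16 * (\<theta> k \<omega>)\<^sup>2)" for k \<omega>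
  define V where "V n \<omega> = (\<Prod>k<n. f k \<omega>)" for n \<omega>
  \<comment> \<open>This crude bound on one factor gives \<open>V n \<le> c ^ n\<close>, which
    secures integrability.\<close>
  define c where "c = 2 * exp (v / 16)"
  have f_bounds: "0 \<le> f k \<omega>" "f k \<omega> \<le> c" if "\<omega> \<in> space M" for k \<omega>
  proof -
    have "exp (v / 16 * (\<theta> k \<omega>)\<^sup>2) \<le> exp (v / 16)"
      using v \<theta>sq_le[OF that, of k] by (simp add: mult_left_le)
    with sqrt_le[OF that, of k] show "0 \<le> f k \<omega>" "f k \<omega> \<le> c"
      unfolding f_def c_def by (auto intro!: mult_mono)
  qed
  have V_bounds: "0 \<le> V n \<omega>" "V n \<omega> \<le> c ^ n" if "\<omega> \<in> space M" for n \<omega>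
    using prod_mono[of "{..<n}" "\<lambda>k. f k \<omega>" "\<lambda>_. c"] f_bounds[OF that]
    by (auto simp: V_def intro: prod_nonneg)
  have V_hist: "V n \<in> borel_measurable (history M \<xi> n)" for n
  proof -
    have [measurable]: "\<theta> k \<in> borel_measurable (history M \<xi> n)"
      "\<xi> k \<in> borel_measurable (history M \<xi> n)" if "k \<in> {..<n}" for k
      using that \<theta>' by (auto intro: measurable_history)
    show ?thesis
      unfolding V_def [abs_def] f_def by measurable
  qed
  have V_meas[measurable]: "random_variable borel (V n)" for n
    by (rule measurable_from_subalg[OF sub V_hist])
  have V_int: "integrable M (V n)" for n
    using V_bounds by (intro integrable_const_bound[where B = "c ^ n"]) auto
  have super: "(LINT \<omega>:A|M. V (Suc n) \<omega>) \<le> (LINT \<omega>:A|M. V n \<omega>)"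
    if A: "A \<in> sets (history M \<xi> n)" for n A
  proof -
    have [measurable]: "A \<in> events"
      using A sub[of n] by (auto simp: subalgebra_def)
    \<comment> \<open>\<open>G\<close> collects what is known before \<open>\<xi> n\<close> is seen;
      the only other factor of \<open>V (Suc n)\<close> on \<open>A\<close> is
      \<open>sqrt (1 + \<theta> n \<omega> * \<xi> n \<omega>)\<close>.\<close>
    define G where "G \<omega> = indicator A \<omega> * V n \<omega> * exp (v / 16 * (\<theta> n \<omega>)\<^sup>2)" for \<omega>
    have G_hist: "G \<in> borel_measurable (history M \<xi> n)"
      unfolding G_def [abs_def] using V_hist \<theta> A by measurable
    have [measurable]: "random_variable borel G"
      by (rule measurable_from_subalg[OF sub G_hist])
    have G_bounds: "0 \<le> G \<omega>" "G \<omega> \<le> c ^ n * exp (v / 16)" if "\<omega> \<in> space M" for \<omega>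
    proof -
      show "0 \<le> G \<omega>"
        using V_bounds[OF that] by (simp add: G_def)
      have "exp (v / 16 * (\<theta> n \<omega>)\<^sup>2) \<le> exp (v / 16)"
        using v \<theta>sq_le[OF that, of n] by (simp add: mult_left_le)
      then show "G \<omega> \<le> c ^ n * exp (v / 16)"
        using V_bounds[OF that, of n]
        by (auto simp: G_def indicator_def intro!: mult_mono)
    qed
    have G_int: "integrable M (\<lambda>\<omega>. G \<omega> * h \<omega>)"
      if [measurable]: "random_variable borel h" and h: "\<And>\<omega>. \<omega> \<in> space M \<Longrightarrow> \<bar>h \<omega>\<bar> \<le> 2" for h
    proof (rule integrable_const_bound[where B = "c ^ n * exp (v / 16) * 2"])
      show "AE \<omega> in M. norm (G \<omega> * h \<omega>) \<le> c ^ n * exp (v / 16) * 2"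
      proof (rule AE_I2)
        fix \<omega> assume \<omega>: "\<omega> \<in> space M"
        have "\<bar>G \<omega>\<bar> * \<bar>h \<omega>\<bar> \<le> c ^ n * exp (v / 16) * 2"
          using G_bounds[OF \<omega>] h[OF \<omega>] by (intro mult_mono) auto
        then show "norm (G \<omega> * h \<omega>) \<le> c ^ n * exp (v / 16) * 2"
          by (simp add: abs_mult)
      qed
    qed measurable
    have \<xi>_int: "integrable M (\<xi> n)" "integrable M (\<lambda>\<omega>. (\<xi> n \<omega>)\<^sup>2)"
      using \<xi>_le by (auto intro!: integrable_const_bound[where B = 1] simp: abs_square_le_1)
    have \<theta>2: "\<bar>\<theta> n \<omega>\<bar> \<le> 2" "\<bar>(\<theta> n \<omega>)\<^sup>2\<bar> \<le> 2" if "\<omega> \<in> space M" for \<omega>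
      using \<theta>_le[OF that, of n] \<theta>sq_le[OF that, of n] by auto
    have G\<theta>: "(\<lambda>\<omega>. G \<omega> * \<theta> n \<omega>) \<in> borel_measurable (history M \<xi> n)"
      "(\<lambda>\<omega>. G \<omega> * (\<theta> n \<omega>)\<^sup>2) \<in> borel_measurable (history M \<xi> n)"
      using G_hist \<theta> by measurable
    have int1: "integrable M (\<lambda>\<omega>. G \<omega> * \<theta> n \<omega>)" and int2: "integrable M (\<lambda>\<omega>. G \<omega> * (\<theta> n \<omega>)\<^sup>2)"
      by (rule G_int; use \<theta>2 in auto)+
    have int0: "integrable M G"
      using G_int[of "\<lambda>_. 1"] by simp
    note m1 = expectation_history_mult[OF indep G\<theta>(1) int1, of "\<lambda>x. x", simplified, OF \<xi>_int(1)]
    note m2 = expectation_history_mult[OF indep G\<theta>(2) int2, of "\<lambda>x. x\<^sup>2", simplified, OF \<xi>_int(2)]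
    have "(LINT \<omega>:A|M. V (Suc n) \<omega>) = expectation (\<lambda>\<omega>. G \<omega> * sqrt (1 + \<theta> n \<omega> * \<xi> n \<omega>))"
      by (simp add: set_lebesgue_integral_def V_def f_def G_def mult_ac)
    also have "\<dots> \<le> expectation (\<lambda>\<omega>. G \<omega> + 1 / 2 * (G \<omega> * \<theta> n \<omega> * \<xi> n \<omega>) - 1 / 16 * (G \<omega> * (\<theta> n \<omega>)\<^sup>2 * (\<xi> n \<omega>)\<^sup>2))"
    proof (rule integral_mono)
      show "integrable M (\<lambda>\<omega>. G \<omega> * sqrt (1 + \<theta> n \<omega> * \<xi> n \<omega>))"
        by (rule G_int) (use sqrt_le in auto)
      show "integrable M (\<lambda>\<omega>. G \<omega> + 1 / 2 * (G \<omega> * \<theta> n \<omega> * \<xi> n \<omega>) - 1 / 16 * (G \<omega> * (\<theta> n \<omega>)\<^sup>2 * (\<xi> n \<omega>)\<^sup>2))"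
        by (intro Bochner_Integration.integrable_diff Bochner_Integration.integrable_add
            integrable_mult_right int0 m1(2) m2(2))
      fix \<omega> assume \<omega>: "\<omega> \<in> space M"
      have "G \<omega> * sqrt (1 + \<theta> n \<omega> * \<xi> n \<omega>)
          \<le> G \<omega> * (1 + \<theta> n \<omega> * \<xi> n \<omega> / 2 - (\<theta> n \<omega> * \<xi> n \<omega>)\<^sup>2 / 16)"
        using G_bounds(1)[OF \<omega>] prod_le[OF \<omega>, of n] by (intro mult_left_mono sqrt_one_plus_le)
      then show "G \<omega> * sqrt (1 + \<theta> n \<omega> * \<xi> n \<omega>) \<le>
          G \<omega> + 1 / 2 * (G \<omega> * \<theta> n \<omega> * \<xi> n \<omega>) - 1 / 16 * (G \<omega> * (\<theta> n \<omega>)\<^sup>2 * (\<xi> n \<omega>)\<^sup>2)"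
        by (simp add: power_mult_distrib algebra_simps)
    qed
    also have "\<dots> = expectation G + 1 / 2 * expectation (\<lambda>\<omega>. G \<omega> * \<theta> n \<omega> * \<xi> n \<omega>)
        - 1 / 16 * expectation (\<lambda>\<omega>. G \<omega> * (\<theta> n \<omega>)\<^sup>2 * (\<xi> n \<omega>)\<^sup>2)"
      using int0 m1(2) m2(2) by simp
    \<comment> \<open>Independence factors both products: the zero mean removes the linear term and
      the second moment turns into \<open>v\<close>.\<close>
    also have "\<dots> = expectation G - v / 16 * expectation (\<lambda>\<omega>. G \<omega> * (\<theta> n \<omega>)\<^sup>2)"
      by (simp add: m1(1) m2(1) mean var)
    also have "\<dots> = expectation (\<lambda>\<omega>. G \<omega> - v / 16 * (G \<omega> * (\<theta> n \<omega>)\<^sup>2))"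
      using int0 int2 by simp
    also have "\<dots> \<le> expectation (\<lambda>\<omega>. indicator A \<omega> * V n \<omega>)"
    proof (rule integral_mono)
      show "integrable M (\<lambda>\<omega>. G \<omega> - v / 16 * (G \<omega> * (\<theta> n \<omega>)\<^sup>2))"
        using int0 int2 by simp
      show "integrable M (\<lambda>\<omega>. indicator A \<omega> * V n \<omega>)"
        using integrable_mult_indicator[OF _ V_int, of A n] by simp
      fix \<omega> assume \<omega>: "\<omega> \<in> space M"
      define y where "y = v / 16 * (\<theta> n \<omega>)\<^sup>2"
      have "exp y * (1 - y) \<le> exp y * exp (- y)"
        using exp_ge_add_one_self[of "- y"] by (intro mult_left_mono) auto
      then have "exp y * (1 - y) \<le> 1"
        by (simp add: exp_minus)
      then have "indicator A \<omega> * V n \<omega> * (exp y * (1 - y)) \<le> indicator A \<omega> * V n \<omega> * 1"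
        using V_bounds[OF \<omega>, of n] by (intro mult_left_mono) auto
      then show "G \<omega> - v / 16 * (G \<omega> * (\<theta> n \<omega>)\<^sup>2) \<le> indicator A \<omega> * V n \<omega>"
        by (simp add: G_def y_def algebra_simps)
    qed
    also have "\<dots> = (LINT \<omega>:A|M. V n \<omega>)"
      by (simp add: set_lebesgue_integral_def)
    finally show ?thesis .
  qed
  have "AE \<omega> in M. \<exists>B. \<forall>n. V n \<omega> \<le> B"
    by (rule AE_supermartingale_bounded[of "history M \<xi>"])
      (use sub sub' V_hist V_int V_bounds super in auto)
  then show ?thesis
    using AE_space
  proof eventually_elim
    case (elim \<omega>)
    then obtain B where B: "\<And>n. V n \<omega> \<le> B"
      by blast
    show ?case
    proof
      assume nsum: "\<not> summable (\<lambda>n. (\<theta> n \<omega>)\<^sup>2)"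
      define Q where "Q n = (\<Sum>k<n. (\<theta> k \<omega>)\<^sup>2)" for n
      define W where "W n = (\<Prod>k<n. 1 + \<theta> k \<omega> * \<xi> k \<omega>)" for n
      \<comment> \<open>A bounded \<open>V\<close> thus bounds the root of the product by a constant
        times \<open>exp (- (v / 16 * Q n))\<close>.\<close>
      have V_eq: "V n \<omega> = sqrt (W n) * exp (v / 16 * Q n)" for n
      proof -
        have "(\<Prod>k<n. sqrt (1 + \<theta> k \<omega> * \<xi> k \<omega>)) = sqrt (W n)"
          unfolding W_def by (induction n) (simp_all only: prod.lessThan_Suc real_sqrt_mult lessThan_0 prod.empty real_sqrt_one)
        then show ?thesis
          by (simp add: V_def f_def Q_def prod.distrib sum_distrib_left exp_sum)
      qed
      have "filterlim Q at_top sequentially"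
        unfolding filterlim_at_top
      proof
        fix Z
        have "\<exists>n0. Q n0 \<ge> Z"
        proof (rule ccontr)
          assume "\<nexists>n0. Q n0 \<ge> Z"
          then have "summable (\<lambda>n. (\<theta> n \<omega>)\<^sup>2)"
            by (intro summableI_nonneg_bounded[where x = Z]) (auto simp: Q_def not_le less_imp_le)
          with nsum show False
            by blast
        qed
        then obtain n0 where "Q n0 \<ge> Z"
          by blast
        moreover have "Q n0 \<le> Q n" if "n \<ge> n0" for n
          unfolding Q_def using that by (intro sum_mono2) auto
        ultimately show "\<forall>\<^sub>F n in sequentially. Z \<le> Q n"
          unfolding eventually_sequentially by (blast intro: order_trans)
      qed
      then have "filterlim (\<lambda>n. - (v / 16 * Q n)) at_bot sequentially"
        unfolding filterlim_uminus_at_top[symmetric]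
        using v by (intro filterlim_tendsto_pos_mult_at_top[OF tendsto_const]) auto
      then have "(\<lambda>n. exp (- (v / 16 * Q n))) \<longlonglongrightarrow> 0"
        by (rule filterlim_compose[OF exp_at_bot])
      then have lim: "(\<lambda>n. B * exp (- (v / 16 * Q n))) \<longlonglongrightarrow> 0"
        by (rule tendsto_mult_right_zero)
      have W_nonneg: "0 \<le> W n" for n
        unfolding W_def by (intro prod_nonneg sqrt_le elim(2))
      have "(\<lambda>n. sqrt (W n)) \<longlonglongrightarrow> 0"
      proof (rule tendsto_sandwich[OF _ _ tendsto_const lim])
        have "sqrt (W n) \<le> B * exp (- (v / 16 * Q n))" for n
          using B[of n] by (simp add: V_eq exp_minus field_simps)
        then show "\<forall>\<^sub>F n in sequentially. sqrt (W n) \<le> B * exp (- (v / 16 * Q n))"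
          by simp
      qed (use W_nonneg in simp)
      from tendsto_power[OF this, of 2] show "(\<lambda>n. \<Prod>k<n. 1 + \<theta> k \<omega> * \<xi> k \<omega>) \<longlonglongrightarrow> 0"
        using W_nonneg by (simp add: W_def [symmetric])
    qed
  qed
qed

text \<open>For variables in an interval of length 2, Hoeffding's inequality bounds a deviation of
  the average by \<delta> with \<open>2 * exp (- (\<delta>\<^sup>2 / 2)) ^ n\<close>. This is
  summable, so Borel-Cantelli applies.\<close>

lemma (in prob_space) AE_average_tendsto_0:
  fixes \<xi> :: "nat \<Rightarrow> 'a \<Rightarrow> real"
  assumes indep: "indep_vars (\<lambda>_. borel) \<xi> UNIV"
    and \<xi>_le: "\<And>n \<omega>. \<omega> \<in> space M \<Longrightarrow> \<bar>\<xi> n \<omega>\<bar> \<le> 1"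
    and mean: "\<And>n. expectation (\<xi> n) = 0"
  shows "AE \<omega> in M. (\<lambda>n. (\<Sum>i<n. \<xi> i \<omega>) / real n) \<longlonglongrightarrow> 0"
proof -
  have [measurable]: "random_variable borel (\<xi> n)" for n
    using indep by (simp add: indep_vars_def2)
  have "AE \<omega> in M. \<forall>\<^sub>F n in sequentially. \<bar>(\<Sum>i<n. \<xi> i \<omega>) / real n\<bar> < \<delta>" if \<delta>: "\<delta> > 0" for \<delta>
  proof -
    define A where "A n = {\<omega> \<in> space M. \<bar>\<Sum>i<n. \<xi> i \<omega>\<bar> \<ge> \<delta> * real n}" for n
    have [measurable]: "A n \<in> events" for n
      unfolding A_def by measurable
    have le: "prob (A n) \<le> 2 * exp (- (\<delta>\<^sup>2 / 2)) ^ n" if "n > 0" for n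
    proof -
      interpret H: Hoeffding_ineq M "{..<n}" \<xi> "\<lambda>_. - 1" "\<lambda>_. 1" "\<Sum>i<n. expectation (\<xi> i)"
      proof unfold_locales
        show "indep_vars (\<lambda>_. borel) \<xi> {..<n}"
          using indep by (rule indep_vars_subset) simp
        show "AE \<omega> in M. \<xi> i \<omega> \<in> {- 1..1}" for i
          using \<xi>_le by (intro AE_I2) (auto simp: abs_le_iff minus_le_iff)
      qed auto
      have "prob (A n) \<le> 2 * exp (- 2 * (\<delta> * real n)\<^sup>2 / (\<Sum>i<n. (1 - - 1)\<^sup>2))"
        using H.Hoeffding_ineq_abs_ge[of "\<delta> * real n"] \<delta> that by (simp add: A_def mean)
      also have "- 2 * (\<delta> * real n)\<^sup>2 / (\<Sum>i<n. (1 - - 1)\<^sup>2) = real n * (- (\<delta>\<^sup>2 / 2))"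
        using that by (simp add: power2_eq_square field_simps)
      finally show ?thesis
        by (simp only: exp_of_nat_mult)
    qed
    have "summable (\<lambda>n. 2 * exp (- (\<delta>\<^sup>2 / 2)) ^ n)"
      using \<delta> by (intro summable_mult summable_geometric) simp
    moreover have "\<forall>\<^sub>F n in sequentially. norm (prob (A n)) \<le> 2 * exp (- (\<delta>\<^sup>2 / 2)) ^ n"
      using eventually_gt_at_top[of 0] by eventually_elim (simp add: le)
    ultimately have "summable (\<lambda>n. prob (A n))"
      by (rule summable_comparison_test_ev[rotated])
    then have "AE \<omega> in M. \<forall>\<^sub>F n in sequentially. \<omega> \<in> space M - A n"
      by (intro borel_cantelli_AE1) (auto simp: emeasure_eq_measure)
    then show ?thesis
    proof eventually_elim
      case (elim \<omega>)
      then show ?case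
        using eventually_gt_at_top[of 0]
        by eventually_elim (auto simp: A_def field_simps)
    qed
  qed
  \<comment> \<open>Countably many thresholds suffice, so the exceptional null sets can be
    united.\<close>
  then have "AE \<omega> in M. \<forall>j. \<forall>\<^sub>F n in sequentially. \<bar>(\<Sum>i<n. \<xi> i \<omega>) / real n\<bar> < 1 / real (Suc j)"
    by (subst AE_all_countable) auto
  then show ?thesis
  proof eventually_elim
    case (elim \<omega>)
    show ?case
    proof (rule tendstoI)
      fix r :: real assume "r > 0"
      then obtain j where j: "1 / real (Suc j) < r"
        using nat_approx_posE by blast
      from elim have "\<forall>\<^sub>F n in sequentially. \<bar>(\<Sum>i<n. \<xi> i \<omega>) / real n\<bar> < 1 / real (Suc j)"
        by blast
      then show "\<forall>\<^sub>F n in sequentially. dist ((\<Sum>i<n. \<xi> i \<omega>) / real n) 0 < r"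
        by eventually_elim (use j in auto)
    qed
  qed
qed

text \<open>Past the last disagreement the two products differ by a constant factor. It is well
  defined because no \<open>g k\<close> vanishes, while early values of \<open>f\<close> may be zero
  or negative.\<close>

lemma prod_tendsto_0_eventually_eq:
  fixes f g :: "nat \<Rightarrow> real"
  assumes lim: "(\<lambda>n. \<Prod>k<n. g k) \<longlonglongrightarrow> 0" and eq: "\<forall>\<^sub>F k in sequentially. f k = g k"
    and nz: "\<And>k. g k \<noteq> 0"
  shows "(\<lambda>n. \<Prod>k<n. f k) \<longlonglongrightarrow> 0"
proof -
  obtain N where N: "\<And>k. k \<ge> N \<Longrightarrow> f k = g k"
    using eq by (auto simp: eventually_sequentially)
  have eq': "(\<Prod>k<N. f k) / (\<Prod>k<N. g k) * (\<Prod>k<n. g k) = (\<Prod>k<n. f k)" if "n \<ge> N" for n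
  proof -
    have split: "(\<Prod>k<n. h k) = (\<Prod>k<N. h k) * (\<Prod>k\<in>{N..<n}. h k)" for h :: "nat \<Rightarrow> real"
      using prod.atLeastLessThan_concat[of 0 N n h] that by (simp add: lessThan_atLeast0)
    have "(\<Prod>k\<in>{N..<n}. f k) = (\<Prod>k\<in>{N..<n}. g k)"
      by (intro prod.cong) (auto simp: N)
    then show ?thesis
      using nz by (simp add: split[of f] split[of g])
  qed
  have "(\<lambda>n. (\<Prod>k<N. f k) / (\<Prod>k<N. g k) * (\<Prod>k<n. g k)) \<longlonglongrightarrow> 0"
    by (rule tendsto_mult_right_zero[OF lim])
  then show ?thesis
  proof (rule Lim_transform_eventually)
    show "\<forall>\<^sub>F n in sequentially. (\<Prod>k<N. f k) / (\<Prod>k<N. g k) * (\<Prod>k<n. g k) = (\<Prod>k<n. f k)"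
      using eventually_ge_at_top[of N] by eventually_elim (rule eq')
  qed
qed

text \<open>Clipping the bets to size \<open>1 / 2\<close> changes only finitely many of them almost
  surely, so divergence of the squares survives. The clipped factors are at least
  \<open>1 / 2\<close>, hence nonzero, and the limit carries over to the original product.\<close>

lemma (in prob_space) AE_shrinking_bets_product_tendsto_0:
  fixes \<xi> \<beta> :: "nat \<Rightarrow> 'a \<Rightarrow> real"
  assumes indep: "indep_vars (\<lambda>_. borel) \<xi> UNIV"
    and \<xi>_le: "\<And>n \<omega>. \<omega> \<in> space M \<Longrightarrow> \<bar>\<xi> n \<omega>\<bar> \<le> 1"
    and mean: "\<And>n. expectation (\<xi> n) = 0"
    and var: "\<And>n. expectation (\<lambda>\<omega>. (\<xi> n \<omega>)\<^sup>2) = v" and v: "v > 0"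
    and \<beta>: "\<And>n. \<beta> n \<in> borel_measurable (history M \<xi> n)"
    and \<beta>_0: "AE \<omega> in M. (\<lambda>n. \<beta> n \<omega>) \<longlonglongrightarrow> 0"
    and nsum: "AE \<omega> in M. \<not> summable (\<lambda>n. (\<beta> n \<omega>)\<^sup>2)"
  shows "AE \<omega> in M. (\<lambda>n. \<Prod>k<n. 1 + \<beta> k \<omega> * \<xi> k \<omega>) \<longlonglongrightarrow> 0"
proof -
  define \<theta> where "\<theta> n \<omega> = max (- 1 / 2) (min (1 / 2) (\<beta> n \<omega>))" for n \<omega>
  have \<theta>_le: "\<bar>\<theta> n \<omega>\<bar> \<le> 1 / 2" for n \<omega>
    by (auto simp: \<theta>_def)
  have "\<theta> n \<in> borel_measurable (history M \<xi> n)" for n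
    unfolding \<theta>_def [abs_def] using \<beta> by measurable
  then have "AE \<omega> in M. \<not> summable (\<lambda>n. (\<theta> n \<omega>)\<^sup>2) \<longrightarrow> (\<lambda>n. \<Prod>k<n. 1 + \<theta> k \<omega> * \<xi> k \<omega>) \<longlonglongrightarrow> 0"
    by (intro AE_betting_product_tendsto_0[OF indep \<xi>_le mean var v] \<theta>_le)
  then show ?thesis
    using \<beta>_0 nsum AE_space
  proof eventually_elim
    case (elim \<omega>)
    have "\<forall>\<^sub>F n in sequentially. dist (\<beta> n \<omega>) 0 < 1 / 2"
      using elim(2) by (rule tendstoD) simp
    then have eq: "\<forall>\<^sub>F n in sequentially. \<theta> n \<omega> = \<beta> n \<omega>"
      by eventually_elim (auto simp: \<theta>_def)
    then have "\<forall>\<^sub>F n in sequentially. (\<theta> n \<omega>)\<^sup>2 = (\<beta> n \<omega>)\<^sup>2"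
      by eventually_elim simp
    then have "\<not> summable (\<lambda>n. (\<theta> n \<omega>)\<^sup>2)"
      using elim(3) by (simp cong: summable_cong)
    with elim(1) have "(\<lambda>n. \<Prod>k<n. 1 + \<theta> k \<omega> * \<xi> k \<omega>) \<longlonglongrightarrow> 0"
      by blast
    then show ?case
    proof (rule prod_tendsto_0_eventually_eq)
      show "\<forall>\<^sub>F k in sequentially. 1 + \<beta> k \<omega> * \<xi> k \<omega> = 1 + \<theta> k \<omega> * \<xi> k \<omega>"
        using eq by eventually_elim simp
      show "1 + \<theta> k \<omega> * \<xi> k \<omega> \<noteq> 0" for k
      proof -
        have "\<bar>\<theta> k \<omega> * \<xi> k \<omega>\<bar> \<le> 1 / 2"
          using mult_mono[OF \<theta>_le[of k \<omega>] \<xi>_le[OF elim(4), of k]] by (simp add: abs_mult)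
        then show ?thesis
          by linarith
      qed
    qed
  qed
qed

section \<open>The Krichevsky-Trofimov bets and their wealth\<close>

theorem proposition2p5:
  fixes M :: "'a measure" and X :: "nat \<Rightarrow> 'a \<Rightarrow> real"
    and P :: "real measure" and m \<sigma> C :: real
  assumes "prob_space M"
    and "real_distribution P"
    and "measure P {0..1} = 1"
    and "prob_space.expectation P (\<lambda>x. x) = m"
    and "prob_space.variance P (\<lambda>x. x) = \<sigma>\<^sup>2"
    and "\<sigma>\<^sup>2 > 0"
    and "prob_space.indep_vars M (\<lambda>_. borel) X {1..}"
    and "\<And>n. n \<ge> 1 \<Longrightarrow> distr M borel (X n) = P"
    and "C \<ge> m * (1 - m)"
  shows "(\<forall>n\<ge>1. \<forall>\<omega>\<in>space M. sqrt (real n) * kt_bet C m X n \<omega>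
            = (1 / 2 + (\<Sum>k\<in>{1..<n}. (X k \<omega> - m))) / (C * sqrt (real n)))
    \<and> weak_conv_m (\<lambda>n. distr M borel (\<lambda>\<omega>. sqrt (real n) * kt_bet C m X n \<omega>))
         (density lborel (normal_density 0 (sqrt (\<sigma>\<^sup>2 / C\<^sup>2))))
    \<and> Omega_p M (kt_bet C m X) (\<lambda>n. real n powr (- 1 / 2))
    \<and> (AE \<omega> in M. (\<lambda>n. kt_wealth C m X n \<omega>) \<longlonglongrightarrow> 0)"
proof -
  interpret prob_space M by fact
  interpret P: real_distribution P by fact
  have X_meas[measurable]: "random_variable borel (X k)" if "k \<in> {1..}" for k
    using assms(7) that by (auto simp: indep_vars_def2)
  have X_Suc_meas[measurable]: "random_variable borel (X (Suc i))" for i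
    by (rule X_meas) simp
  have X_distr: "distr M borel (X (Suc i)) = P" for i
    by (rule assms(8)) simp
  have unit: "AE x in P. 0 \<le> x \<and> x \<le> 1"
    using P.AE_prob_1[OF assms(3)] by simp
  have int_x: "integrable P (\<lambda>x. x)" "integrable P (\<lambda>x. x\<^sup>2)"
  proof -
    have "AE x in P. norm x \<le> 1"
      using unit by eventually_elim simp
    then show "integrable P (\<lambda>x. x)"
      by (rule P.integrable_const_bound) simp
    have "AE x in P. norm (x\<^sup>2) \<le> 1"
      using unit by eventually_elim (simp add: power_le_one)
    then show "integrable P (\<lambda>x. x\<^sup>2)"
      by (rule P.integrable_const_bound) simp
  qed
  have "0 \<le> m"
    unfolding assms(4)[symmetric] using unit by (auto intro!: integral_nonneg_AE)
  have "m \<le> 1"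
    unfolding assms(4)[symmetric] using unit int_x by (auto intro!: P.integral_le_const)
  \<comment> \<open>This yields \<open>\<sigma>\<^sup>2 \<le> m * (1 - m) \<le> C\<close>, and
    positivity of \<open>C\<close> follows from that of the variance.\<close>
  have "AE x in P. x\<^sup>2 \<le> x"
    using unit by eventually_elim (simp add: power2_eq_square mult_left_le)
  then have "P.expectation (\<lambda>x. x\<^sup>2) \<le> P.expectation (\<lambda>x. x)"
    by (intro integral_mono_AE int_x)
  moreover have "\<sigma>\<^sup>2 = P.expectation (\<lambda>x. x\<^sup>2) - m\<^sup>2"
    using P.variance_eq[OF int_x] assms(5) by (simp only: assms(4))
  ultimately have "\<sigma>\<^sup>2 \<le> m * (1 - m)"
    using assms(4) by (simp add: power2_eq_square algebra_simps)
  with assms(6,9) have C: "C > 0"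
    by linarith
  have \<sigma>: "\<bar>\<sigma>\<bar> > 0"
    using assms(6) by simp

  \<comment> \<open>\<open>X\<close> lies in \<open>[0, 1]\<close> only almost surely; clipping makes the bounds hold everywhere.\<close>
  define h where "h x = max 0 (min 1 x) - m" for x :: real
  have h_meas[measurable]: "h \<in> borel_measurable borel"
    unfolding h_def [abs_def] by measurable
  have h_le: "\<bar>h x\<bar> \<le> 1" for x
    using \<open>0 \<le> m\<close> \<open>m \<le> 1\<close> by (auto simp: h_def)
  have h_eq: "AE x in P. h x = x - m"
    using unit by eventually_elim (simp add: h_def)
  \<comment> \<open>The shift by one leaves out \<open>X 0\<close>, about which nothing is
    assumed.\<close>
  define \<xi> where "\<xi> i \<omega> = h (X (Suc i) \<omega>)" for i \<omega>
  have \<xi>_meas[measurable]: "random_variable borel (\<xi> i)" for i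
    unfolding \<xi>_def [abs_def] by measurable
  have "indep_vars (\<lambda>_. borel) (\<lambda>i. X (Suc i)) UNIV"
    using assms(7) by (intro indep_vars_reindex[of "\<lambda>_. borel" X "{1..}" Suc]) auto
  then have indep: "indep_vars (\<lambda>_. borel) \<xi> UNIV"
    unfolding \<xi>_def [abs_def] by (rule indep_vars_compose2) measurable
  have expect: "expectation (\<lambda>\<omega>. g (\<xi> i \<omega>)) = P.expectation (\<lambda>x. g (x - m))"
    if [measurable]: "g \<in> borel_measurable borel" for g :: "real \<Rightarrow> real" and i
  proof -
    have "expectation (\<lambda>\<omega>. g (\<xi> i \<omega>)) = integral\<^sup>L (distr M borel (X (Suc i))) (\<lambda>x. g (h x))"
      unfolding \<xi>_def by (rule integral_distr[symmetric]) measurable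
    also have "\<dots> = P.expectation (\<lambda>x. g (x - m))"
      unfolding X_distr
      by (rule integral_cong_AE) (measurable, use h_eq in \<open>auto elim!: eventually_mono\<close>)
    finally show ?thesis .
  qed
  have mean: "expectation (\<xi> i) = 0" for i
  proof -
    have "expectation (\<xi> i) = P.expectation (\<lambda>x. x - m)"
      by (rule expect) measurable
    also have "\<dots> = P.expectation (\<lambda>x. x) - m"
      using Bochner_Integration.integral_diff[OF int_x(1) P.integrable_const, of m]
      by (simp add: P.prob_space del: P.space_eq_univ)
    finally show ?thesis
      by (simp add: assms(4))
  qed
  have var: "expectation (\<lambda>\<omega>. (\<xi> i \<omega>)\<^sup>2) = \<sigma>\<^sup>2" for i
  proof -
    have "expectation (\<lambda>\<omega>. (\<xi> i \<omega>)\<^sup>2) = P.expectation (\<lambda>x. (x - m)\<^sup>2)"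
      by (rule expect) measurable
    then show ?thesis
      using assms(5) by (simp only: assms(4))
  qed
  have distr: "distr M borel (\<xi> i) = distr P borel h" for i
    unfolding X_distr[of i, symmetric] by (subst distr_distr) (auto simp: comp_def \<xi>_def [abs_def])
  have "AE \<omega> in M. \<xi> i \<omega> = X (Suc i) \<omega> - m" for i
    unfolding \<xi>_def
    by (rule AE_distrD[OF X_Suc_meas[of i], unfolded X_distr, of "\<lambda>x. h x = x - m", OF h_eq])
  then have "AE \<omega> in M. \<forall>i. \<xi> i \<omega> = X (Suc i) \<omega> - m"
    by (simp add: AE_all_countable)
  then have X_eq: "AE \<omega> in M. \<forall>i. X (Suc i) \<omega> - m = \<xi> i \<omega>"
    by eventually_elim simp

  \<comment> \<open>\<open>\<beta> n\<close> is bet number \<open>n + 1\<close>. It uses only the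
    first \<open>n\<close> variables, so it is determined before \<open>\<xi> n\<close>.\<close>
  define \<beta> where "\<beta> n \<omega> = (1 / 2 + (\<Sum>i<n. \<xi> i \<omega>)) / (C * real (Suc n))" for n \<omega>
  have bet_meas[measurable]: "random_variable borel (kt_bet C m X n)" for n
    unfolding kt_bet_def [abs_def] by measurable
  have sum_Suc: "(\<Sum>k\<in>{1..<Suc n}. (X k \<omega> - m)) = (\<Sum>i<n. X (Suc i) \<omega> - m)" for n \<omega>
    by (simp only: One_nat_def sum.shift_bounds_Suc_ivl lessThan_atLeast0)
  have bet_eq: "AE \<omega> in M. \<forall>n. kt_bet C m X (Suc n) \<omega> = \<beta> n \<omega>"
    using X_eq
    by eventually_elim (simp only: kt_bet_def \<beta>_def sum_Suc simp_thms)

  have scaled: "sqrt (real n) * kt_bet C m X n \<omega>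
      = (1 / 2 + (\<Sum>k\<in>{1..<n}. (X k \<omega> - m))) / (C * sqrt (real n))" for n \<omega>
  proof -
    have "s * (y / (C * (s * s))) = y / (C * s)" for s y :: real
      by simp
    from this[of "sqrt (real n)"] show ?thesis
      by (simp add: kt_bet_def)
  qed

  \<comment> \<open>Weak limit and order in probability\<close>
  have "weak_conv_m (\<lambda>n. distr M borel (\<lambda>\<omega>. (1 / 2 + (\<Sum>i<n. \<xi> i \<omega>)) / (C * sqrt (real (Suc n)))))
      (density lborel (normal_density 0 (\<bar>\<sigma>\<bar> / C)))"
  proof (rule central_limit_theorem_affine[OF indep mean \<sigma> _ _ distr C])
    show "integrable M (\<lambda>\<omega>. (\<xi> n \<omega>)\<^sup>2)" for n
      by (rule integrable_const_bound[where B = 1]) (auto simp: \<xi>_def abs_square_le_1 h_le)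
    show "variance (\<xi> n) = \<bar>\<sigma>\<bar>\<^sup>2" for n
      by (simp add: mean var)
  qed
  moreover have "distr M borel (\<lambda>\<omega>. (1 / 2 + (\<Sum>i<n. \<xi> i \<omega>)) / (C * sqrt (real (Suc n)))) =
      distr M borel (\<lambda>\<omega>. sqrt (real (Suc n)) * kt_bet C m X (Suc n) \<omega>)" for n
  proof (rule distr_cong_AE)
    show "AE \<omega> in M. (1 / 2 + (\<Sum>i<n. \<xi> i \<omega>)) / (C * sqrt (real (Suc n))) =
        sqrt (real (Suc n)) * kt_bet C m X (Suc n) \<omega>"
      using X_eq unfolding scaled by eventually_elim (simp only: sum_Suc)
  qed simp_all
  \<comment> \<open>Convergence along \<open>Suc n\<close> implies convergence along
    \<open>n\<close>, and \<open>C > 0\<close> identifies \<open>\<bar>\<sigma>\<bar> / C\<close>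
    with the stated standard deviation.\<close>
  ultimately have weak: "weak_conv_m (\<lambda>n. distr M borel (\<lambda>\<omega>. sqrt (real n) * kt_bet C m X n \<omega>))
      (density lborel (normal_density 0 (sqrt (\<sigma>\<^sup>2 / C\<^sup>2))))"
    using C unfolding weak_conv_m_def weak_conv_def
    by (auto simp: real_sqrt_divide intro: LIMSEQ_imp_Suc)

  have omega: "Omega_p M (kt_bet C m X) (\<lambda>n. real n powr (- 1 / 2))"
  proof (rule Omega_p_if_weak_conv)
    have root: "sqrt (real n) * y = y / real n powr (- 1 / 2)" for n y
    proof -
      have "real n powr (- 1 / 2) = inverse (sqrt (real n))"
        by (simp add: powr_minus powr_half_sqrt)
      then show ?thesis
        by (simp only: divide_inverse inverse_inverse_eq mult.commute)
    qed
    show "weak_conv_m (\<lambda>n. distr M borel (\<lambda>\<omega>. kt_bet C m X n \<omega> / real n powr (- 1 / 2)))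
        (density lborel (normal_density 0 (sqrt (\<sigma>\<^sup>2 / C\<^sup>2))))"
      using weak unfolding root .
    show "isCont (cdf (density lborel (normal_density 0 (sqrt (\<sigma>\<^sup>2 / C\<^sup>2))))) x" for x
      using C assms(6) by (intro isCont_cdf_normal) simp
    show "\<forall>\<^sub>F n in sequentially. real n powr (- 1 / 2) > 0"
      using eventually_gt_at_top[of 0] by eventually_elim simp
  qed measurable

  \<comment> \<open>Almost sure decay of the wealth\<close>
  have "AE \<omega> in M. \<not> summable (\<lambda>n. (kt_bet C m X n \<omega>)\<^sup>2)"
    by (rule AE_not_summable_square_if_Omega_p[OF bet_meas omega])
  with bet_eq have nsum: "AE \<omega> in M. \<not> summable (\<lambda>n. (\<beta> n \<omega>)\<^sup>2)"
  proof eventually_elim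
    case (elim \<omega>)
    then show ?case
      using summable_Suc_iff[of "\<lambda>n. (kt_bet C m X n \<omega>)\<^sup>2"] by simp
  qed

  have "AE \<omega> in M. (\<lambda>n. (\<Sum>i<n. \<xi> i \<omega>) / real n) \<longlonglongrightarrow> 0"
    by (rule AE_average_tendsto_0[OF indep _ mean]) (simp add: \<xi>_def h_le)
  then have \<beta>_0: "AE \<omega> in M. (\<lambda>n. \<beta> n \<omega>) \<longlonglongrightarrow> 0"
  proof eventually_elim
    case (elim \<omega>)
    have "(\<lambda>n. 1 / real (Suc n)) \<longlonglongrightarrow> 0"
      by real_asymp
    moreover have "(\<lambda>n. real n / real (Suc n)) \<longlonglongrightarrow> 1"
      by real_asymp
    \<comment> \<open>The bet splits into the vanishing contribution of the initial
      \<open>1 / 2\<close> and the average, rescaled from \<open>n\<close> to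
      \<open>n + 1\<close>.\<close>
    ultimately have "(\<lambda>n. 1 / 2 / C * (1 / real (Suc n)) +
        1 / C * ((\<Sum>i<n. \<xi> i \<omega>) / real n * (real n / real (Suc n)))) \<longlonglongrightarrow> 1 / 2 / C * 0 + 1 / C * (0 * 1)"
      by (intro tendsto_add tendsto_mult_left tendsto_mult elim)
    moreover have "1 / 2 / C * (1 / real (Suc n)) + 1 / C * ((\<Sum>i<n. \<xi> i \<omega>) / real n * (real n / real (Suc n)))
        = \<beta> n \<omega>" for n
      by (cases "n = 0") (simp_all add: \<beta>_def add_divide_distrib)
    ultimately show ?case
      by simp
  qed

  have "AE \<omega> in M. (\<lambda>n. \<Prod>k<n. 1 + \<beta> k \<omega> * \<xi> k \<omega>) \<longlonglongrightarrow> 0"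
  proof (rule AE_shrinking_bets_product_tendsto_0[OF indep _ mean var assms(6) _ \<beta>_0 nsum])
    show "\<bar>\<xi> n \<omega>\<bar> \<le> 1" for n \<omega>
      by (simp add: \<xi>_def h_le)
    show "\<beta> n \<in> borel_measurable (history M \<xi> n)" for n
    proof -
      have [measurable]: "\<xi> i \<in> borel_measurable (history M \<xi> n)" if "i \<in> {..<n}" for i
        using that by (simp add: measurable_history)
      show ?thesis
        unfolding \<beta>_def [abs_def] by measurable
    qed
  qed
  with bet_eq X_eq have wealth: "AE \<omega> in M. (\<lambda>n. kt_wealth C m X n \<omega>) \<longlonglongrightarrow> 0"
    by eventually_elim (simp add: kt_wealth_def prod.atLeast1_atMost_eq)

  show ?thesis
    using scaled weak omega wealth by blast
qed

end
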